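(* Let $f(n,k)$ denote the number of intervals of rank $k$ in the middle order $\mathcal{P}_n$ ($n\ge1$, $k\ge0$). Then $f(1,0)=1$, and for $n\ge 2$ and $k\in[0,\binom{n}{2}]$, $$f(n,k)=\sum_{h=0}^{n-1}(n-h)\, f(n-1,k-h),$$ with the convention $f(n,j)=0$ for $j<0$.
   Context: For $w\in S_n$ (one-line notation), its inversion sequence is $I(w)=(x_1,\ldots,x_n)$ with $x_i=\#\{j<i : w^{-1}(j)>w^{-1}(i)\}$. The middle order $\mathcal{P}_n$ is the poset on $S_n$ with $v\le w$ iff $I(v)\le I(w)$ coordinate-wise. It is graded with rank function $r(w)$ equal to the number of inversions of $w$ (the sum of the entries of $I(w)$); the rank of an interval $[v,w]$ is $r(w)-r(v)$. *)

theory Defs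
  imports "HOL-Combinatorics.Permutations"
begin

definition perms_upto :: "nat \<Rightarrow> (nat \<Rightarrow> nat) set" where
  "perms_upto n = {w. w permutes {1..n}}"

text \<open>The \<open>i\<close>-th entry (with \<open>1 \<le> i \<le> n\<close>) of the inversion sequence of \<open>w\<close>; it does not depend on \<open>n\<close>.\<close>

definition inv_seq :: "(nat \<Rightarrow> nat) \<Rightarrow> nat \<Rightarrow> nat" where
  "inv_seq w i = card {j \<in> {1..<i}. inv w j > inv w i}"

definition middle_le :: "nat \<Rightarrow> (nat \<Rightarrow> nat) \<Rightarrow> (nat \<Rightarrow> nat) \<Rightarrow> bool" where
  "middle_le n v w \<longleftrightarrow> v \<in> perms_upto n \<and> w \<in> perms_upto n \<and> (\<forall>i\<in>{1..n}. inv_seq v i \<le> inv_seq w i)"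

definition inversions :: "nat \<Rightarrow> (nat \<Rightarrow> nat) \<Rightarrow> (nat \<times> nat) set" where
  "inversions n w = {(i, j). i \<in> {1..n} \<and> j \<in> {1..n} \<and> i < j \<and> w i > w j}"

definition middle_rank :: "nat \<Rightarrow> (nat \<Rightarrow> nat) \<Rightarrow> nat" where
  "middle_rank n w = card (inversions n w)"

lemma middle_rank_eq_sum_inv_seq:
  assumes "w \<in> perms_upto n"
  shows "middle_rank n w = (\<Sum>i\<in>{1..n}. inv_seq w i)"
proof -
  have w: "w permutes {1..n}" using assms by (simp add: perms_upto_def)
  have w': "inv w permutes {1..n}" using w by (rule permutes_inv)
  let ?S = "SIGMA i:{1..n}. {j \<in> {1..<i}. inv w j > inv w i}"
  have "bij_betw (\<lambda>(i, j). (w i, w j)) (inversions n w) ?S"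
  proof (rule bij_betw_byWitness[where f' = "\<lambda>(i, j). (inv w i, inv w j)"])
    show "(\<lambda>(i, j). (w i, w j)) ` inversions n w \<subseteq> ?S"
      using permutes_in_image[OF w] permutes_inverses[OF w]
      by (fastforce simp: inversions_def)
    show "(\<lambda>(i, j). (inv w i, inv w j)) ` ?S \<subseteq> inversions n w"
      using permutes_in_image[OF w'] permutes_inverses[OF w]
      by (fastforce simp: inversions_def)
  qed (use permutes_inverses[OF w] in auto)
  then have "card (inversions n w) = card ?S" by (rule bij_betw_same_card)
  also have "\<dots> = (\<Sum>i\<in>{1..n}. inv_seq w i)"
    by (simp add: inv_seq_def)
  finally show ?thesis by (simp add: middle_rank_def)
qed

definition middle_interval :: "nat \<Rightarrow> (nat \<Rightarrow> nat) \<Rightarrow> (nat \<Rightarrow> nat) \<Rightarrow> (nat \<Rightarrow> nat) set" where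
  "middle_interval n v w = {u. middle_le n v u \<and> middle_le n u w}"

text \<open>Intervals are counted as subsets of the poset. Only \<open>[v,w]\<close> with \<open>v \<le> w\<close> are intervals, so the
  empty set does not count.\<close>

definition intervals_of_rank :: "nat \<Rightarrow> int \<Rightarrow> (nat \<Rightarrow> nat) set set" where
  "intervals_of_rank n k =
     {middle_interval n v w |v w. middle_le n v w \<and> int (middle_rank n w) - int (middle_rank n v) = k}"

text \<open>The rank argument is an integer in order to express the convention that the number is \<open>0\<close> in negative rank.\<close>

definition num_intervals :: "nat \<Rightarrow> int \<Rightarrow> nat" where
  "num_intervals n k = (if k < 0 then 0 else card (intervals_of_rank n k))"

end

theory Submission
  imports Defs "HOL-Library.FuncSet"
begin

text \<open>Taking inversion sequences identifies \<open>S\<^sub>n\<close> with the box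
  \<open>{0} \<times> {0,1} \<times> \<dots> \<times> {0,\<dots>,n-1}\<close>: the last entry of the sequence determines the last value of
  \<open>w\<^sup>-\<^sup>1\<close>, so the map is injective by induction, and both sets have \<open>n!\<close> elements. An interval
  is therefore a pair \<open>x \<le> y\<close> of points of the box, and its rank is the sum of the differences
  \<open>y\<^sub>i - x\<^sub>i\<close>. Splitting off the last coordinate, a difference of \<open>h\<close> there can occur in \<open>n - h\<close> ways.\<close>

text \<open>Extensional functions, so that a point is its entries at \<open>1..n\<close> and nothing
  else.\<close>

definition inv_box :: "nat \<Rightarrow> (nat \<Rightarrow> nat) set" where
  "inv_box n = PiE {1..n} (\<lambda>i. {..<i})"

lemma finite_inv_box: "finite (inv_box n)"
  by (auto simp: inv_box_def intro: finite_PiE)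

lemma card_inv_box: "card (inv_box n) = fact n"
  by (simp add: inv_box_def card_PiE fact_prod)

text \<open>If \<open>c < d\<close>, then everything above \<open>d\<close> is above
  \<open>c\<close>, and so is \<open>d\<close> itself; hence the count strictly drops as the element
  grows.\<close>

lemma eq_if_card_greater_eq:
  fixes a b :: "'a :: linorder"
  assumes "finite A" "a \<in> A" "b \<in> A" and "card {y\<in>A. a < y} = card {y\<in>A. b < y}"
  shows "a = b"
proof -
  have less: "card {y\<in>A. d < y} < card {y\<in>A. c < y}" if "c < d" "d \<in> A" for c d
    by (rule psubset_card_mono) (use assms(1) that in auto)
  show ?thesis
    using less[of a b] less[of b a] assms by (cases a b rule: linorder_cases) auto
qed

text \<open>Induction on \<open>m\<close>, recovering the last value first: its count fixes its
  position from the top in the common image. Deleting it leaves equal images on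
  \<open>{1..m}\<close>.\<close>

lemma eq_if_inversion_counts_eq:
  fixes u v :: "nat \<Rightarrow> 'a :: linorder"
  assumes "inj_on u {1..m}" "inj_on v {1..m}" "u ` {1..m} = v ` {1..m}"
    and "\<forall>i\<in>{1..m}. card {j\<in>{1..<i}. u i < u j} = card {j\<in>{1..<i}. v i < v j}"
    and "i \<in> {1..m}"
  shows "u i = v i"
  using assms
proof (induction m)
  case 0
  then show ?case by simp
next
  case (Suc m)
  have ins: "{1..Suc m} = insert (Suc m) {1..m}" by auto
  \<comment> \<open>Every other position precedes \<open>Suc m\<close>, so by injectivity its
    inversions correspond to the larger values in the whole image.\<close>
  have count: "card {j\<in>{1..<Suc m}. f (Suc m) < f j} = card {y\<in>f ` {1..Suc m}. f (Suc m) < y}"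
    if "inj_on f {1..Suc m}" for f :: "nat \<Rightarrow> 'a"
  proof -
    have "{y\<in>f ` {1..Suc m}. f (Suc m) < y} = f ` {j\<in>{1..<Suc m}. f (Suc m) < f j}"
      unfolding ins by (auto simp: less_Suc_eq_le)
    moreover have "inj_on f {j\<in>{1..<Suc m}. f (Suc m) < f j}"
      by (rule inj_on_subset[OF that]) auto
    ultimately show ?thesis by (simp add: card_image)
  qed
  have last: "u (Suc m) = v (Suc m)"
  proof (rule eq_if_card_greater_eq)
    show "card {y\<in>u ` {1..Suc m}. u (Suc m) < y} = card {y\<in>u ` {1..Suc m}. v (Suc m) < y}"
      using count[OF Suc.prems(1)] count[OF Suc.prems(2)] Suc.prems(3,4) by simp
    show "v (Suc m) \<in> u ` {1..Suc m}"
      unfolding Suc.prems(3) by simp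
  qed auto
  have del: "f ` {1..m} = f ` {1..Suc m} - {f (Suc m)}" if "inj_on f {1..Suc m}" for f :: "nat \<Rightarrow> 'a"
    using that unfolding ins by (auto simp: inj_on_def)
  show ?case
  proof (cases "i = Suc m")
    case False
    show ?thesis
    proof (rule Suc.IH)
      show "inj_on u {1..m}" "inj_on v {1..m}"
        using Suc.prems(1,2) by (auto simp: inj_on_def)
      show "u ` {1..m} = v ` {1..m}"
        using del[OF Suc.prems(1)] del[OF Suc.prems(2)] Suc.prems(3) last by simp
    qed (use Suc.prems(4,5) False in auto)
  qed (use last in simp)
qed

text \<open>\<open>inv_seq\<close> compares values of the inverse permutation, so the inverses are
  what the counts recover; outside \<open>{1..n}\<close> both are the identity.\<close>

lemma eq_if_inv_seq_eq:
  assumes "v \<in> perms_upto n" "w \<in> perms_upto n" "\<forall>i\<in>{1..n}. inv_seq v i = inv_seq w i"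
  shows "v = w"
proof -
  have p: "inv v permutes {1..n}" "inv w permutes {1..n}"
    using assms(1,2) by (auto simp: perms_upto_def permutes_inv)
  have on: "inv v i = inv w i" if "i \<in> {1..n}" for i
    using that assms(3) p by (intro eq_if_inversion_counts_eq[where m = n])
      (auto simp: permutes_inj_on permutes_image inv_seq_def)
  have "inv v i = inv w i" for i
    by (cases "i \<in> {1..n}") (simp_all only: on permutes_not_in[OF p(1)] permutes_not_in[OF p(2)] not_False_eq_True)
  then have "inv (inv v) = inv (inv w)" by presburger
  then show ?thesis
    using assms(1,2) by (simp add: perms_upto_def permutes_inv_inv)
qed

lemma inv_seq_less: "1 \<le> i \<Longrightarrow> inv_seq w i < i"
  using card_mono[of "{1..<i}" "{j\<in>{1..<i}. inv w j > inv w i}"] by (fastforce simp: inv_seq_def)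

lemma bij_betw_inv_seq:
  "bij_betw (\<lambda>w. restrict (inv_seq w) {1..n}) (perms_upto n) (inv_box n)"
proof -
  let ?f = "\<lambda>w. restrict (inv_seq w) {1..n}"
  have inj: "inj_on ?f (perms_upto n)"
  proof (rule inj_onI)
    fix v w assume "v \<in> perms_upto n" "w \<in> perms_upto n" and eq: "?f v = ?f w"
    moreover have "inv_seq v i = inv_seq w i" if "i \<in> {1..n}" for i
      using fun_cong[OF eq, of i] that by simp
    ultimately show "v = w" using eq_if_inv_seq_eq by blast
  qed
  moreover have "?f ` perms_upto n = inv_box n"
  proof (rule card_subset_eq[OF finite_inv_box])
    show "?f ` perms_upto n \<subseteq> inv_box n"
      by (auto simp: inv_box_def inv_seq_less)
    show "card (?f ` perms_upto n) = card (inv_box n)"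
      using card_permutations[of "{1..n}" n]
      unfolding card_image[OF inj] card_inv_box
      unfolding perms_upto_def by simp
  qed
  ultimately show ?thesis by (simp add: bij_betw_def)
qed

text \<open>The intervals in coordinates. Integer differences avoid truncated subtraction and make
  the set empty for negative \<open>k\<close>, matching the convention for
  \<open>num_intervals\<close>.\<close>

definition box_pairs :: "nat \<Rightarrow> int \<Rightarrow> ((nat \<Rightarrow> nat) \<times> (nat \<Rightarrow> nat)) set" where
  "box_pairs n k = {(x, y). x \<in> inv_box n \<and> y \<in> inv_box n \<and> (\<forall>i\<in>{1..n}. x i \<le> y i) \<and>
     (\<Sum>i\<in>{1..n}. int (y i) - int (x i)) = k}"

lemma finite_box_pairs: "finite (box_pairs n k)"
  by (rule finite_subset[of _ "inv_box n \<times> inv_box n"]) (auto simp: box_pairs_def finite_inv_box)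

lemma box_pairs_neg: "k < 0 \<Longrightarrow> box_pairs n k = {}"
proof -
  have "0 \<le> (\<Sum>i\<in>{1..n}. int (y i) - int (x i))" if "\<forall>i\<in>{1..n}. x i \<le> y i" for x y :: "nat \<Rightarrow> nat"
    using that by (intro sum_nonneg) auto
  then show "k < 0 \<Longrightarrow> box_pairs n k = {}"
    by (force simp: box_pairs_def)
qed

text \<open>The endpoints are the least and the greatest element of the interval, and the order is
  antisymmetric because inversion sequences determine permutations.\<close>

lemma middle_interval_inj:
  assumes "middle_le n v w" "middle_le n v' w'" "middle_interval n v w = middle_interval n v' w'"
  shows "v = v' \<and> w = w'"
proof -
  have "v \<in> middle_interval n v w" "w \<in> middle_interval n v w"
    "v' \<in> middle_interval n v' w'" "w' \<in> middle_interval n v' w'"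
    using assms(1,2) by (auto simp: middle_interval_def middle_le_def)
  then have "middle_le n v v'" "middle_le n v' v" "middle_le n w w'" "middle_le n w' w"
    using assms(3) by (auto simp: middle_interval_def)
  then show ?thesis
    by (auto simp: middle_le_def intro!: eq_if_inv_seq_eq[of _ n] intro: le_antisym)
qed

lemma num_intervals_eq_card_box_pairs: "num_intervals n k = card (box_pairs n k)"
proof (cases "k < 0")
  case False
  let ?P = "{(v, w). middle_le n v w \<and> int (middle_rank n w) - int (middle_rank n v) = k}"
  let ?f = "\<lambda>w. restrict (inv_seq w) {1..n}"
  have "intervals_of_rank n k = (\<lambda>(v, w). middle_interval n v w) ` ?P"
    by (auto simp: intervals_of_rank_def)
  moreover have "inj_on (\<lambda>(v, w). middle_interval n v w) ?P"
    by (rule inj_onI) (use middle_interval_inj in fastforce)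
  ultimately have "card (intervals_of_rank n k) = card ?P"
    by (simp add: card_image)
  also have "bij_betw (map_prod ?f ?f) ?P (box_pairs n k)"
  proof -
    have inj: "inj_on ?f (perms_upto n)" and im: "?f ` perms_upto n = inv_box n"
      using bij_betw_inv_seq by (auto simp: bij_betw_def)
    \<comment> \<open>The rank is the sum of the inversion sequence, so the rank of the interval
      becomes the sum of the coordinate differences.\<close>
    have mem: "(v, w) \<in> ?P \<longleftrightarrow> (?f v, ?f w) \<in> box_pairs n k"
      if "v \<in> perms_upto n" "w \<in> perms_upto n" for v w
    proof -
      have "?f v \<in> inv_box n" "?f w \<in> inv_box n"
        using that im by blast+
      then show ?thesis
        using that
        by (simp add: box_pairs_def middle_le_def middle_rank_eq_sum_inv_seq sum_subtractf)
    qed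
    have sub: "?P \<subseteq> perms_upto n \<times> perms_upto n"
      by (auto simp: middle_le_def)
    have "inj_on (map_prod ?f ?f) ?P"
      using map_prod_inj_on[OF inj inj] sub by (rule inj_on_subset)
    moreover have "map_prod ?f ?f ` ?P = box_pairs n k"
    proof
      show "map_prod ?f ?f ` ?P \<subseteq> box_pairs n k"
        using sub mem by fastforce
      show "box_pairs n k \<subseteq> map_prod ?f ?f ` ?P"
      proof
        fix p assume p: "p \<in> box_pairs n k"
        then have "fst p \<in> ?f ` perms_upto n" "snd p \<in> ?f ` perms_upto n"
          unfolding im by (auto simp: box_pairs_def)
        then obtain v w where vw: "v \<in> perms_upto n" "w \<in> perms_upto n" "p = (?f v, ?f w)"
          by (metis (no_types, lifting) imageE prod.collapse)
        then have "(v, w) \<in> ?P" using mem p by blast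
        then show "p \<in> map_prod ?f ?f ` ?P"
          using vw(3) by (metis (no_types, lifting) map_prod_simp image_eqI)
      qed
    qed
    ultimately show ?thesis by (simp add: bij_betw_def)
  qed
  then have "card ?P = card (box_pairs n k)" by (rule bij_betw_same_card)
  finally show ?thesis using False by (simp add: num_intervals_def)
qed (simp add: num_intervals_def box_pairs_neg)

lemma inv_box_Suc_upd: "x \<in> inv_box n \<Longrightarrow> a \<le> n \<Longrightarrow> x(Suc n := a) \<in> inv_box (Suc n)"
  by (auto simp: inv_box_def PiE_iff extensional_def le_Suc_eq)

text \<open>Resetting an entry to \<open>undefined\<close>, the value of extensional functions off
  their domain, drops that coordinate.\<close>

lemma inv_box_upd_undefined: "x \<in> inv_box (Suc n) \<Longrightarrow> x(Suc n := undefined) \<in> inv_box n"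
  by (auto simp: inv_box_def PiE_iff extensional_def le_Suc_eq)

lemma inv_box_last_le: "x \<in> inv_box (Suc n) \<Longrightarrow> x (Suc n) \<le> n"
  by (force simp: inv_box_def PiE_iff simp flip: less_Suc_eq_le)

lemma inv_box_upd_id: "x \<in> inv_box n \<Longrightarrow> x(Suc n := undefined) = x"
  by (auto simp: inv_box_def PiE_iff extensional_def)

text \<open>Let \<open>a\<close> and \<open>a + h\<close> be the last entries of the two points. The
  bound \<open>a + h \<le> n\<close> leaves \<open>Suc n - h\<close> choices of \<open>a\<close>,
  and the remaining coordinates contribute \<open>k - h\<close>.\<close>

lemma card_box_pairs_Suc:
  "card (box_pairs (Suc n) k) = (\<Sum>h = 0..n. (Suc n - h) * card (box_pairs n (k - int h)))"
proof -
  let ?S = "SIGMA h:{0..n}. {..<Suc n - h} \<times> box_pairs n (k - int h)"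
  let ?F = "\<lambda>(h, a, x, y). (x(Suc n := a), y(Suc n := a + h))"
  let ?G = "\<lambda>(x, y). (y (Suc n) - x (Suc n), x (Suc n), x(Suc n := undefined), y(Suc n := undefined))"
  have "bij_betw ?F ?S (box_pairs (Suc n) k)"
  proof (rule bij_betw_byWitness[where f' = ?G])
    show "\<forall>s\<in>?S. ?G (?F s) = s"
      by (auto simp: box_pairs_def inv_box_upd_id)
    show "\<forall>p\<in>box_pairs (Suc n) k. ?F (?G p) = p"
      by (auto simp: box_pairs_def)
    show "?F ` ?S \<subseteq> box_pairs (Suc n) k"
      by (auto simp: box_pairs_def inv_box_Suc_upd le_Suc_eq)
    show "?G ` box_pairs (Suc n) k \<subseteq> ?S"
      by (auto simp: box_pairs_def inv_box_upd_undefined of_nat_diff dest: inv_box_last_le)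
  qed
  then have "card (box_pairs (Suc n) k) = card ?S"
    by (rule bij_betw_same_card[symmetric])
  also have "\<dots> = (\<Sum>h = 0..n. (Suc n - h) * card (box_pairs n (k - int h)))"
    by (simp add: card_cartesian_product finite_box_pairs)
  finally show ?thesis .
qed

theorem theorem3p4:
  shows "num_intervals 1 0 = 1 \<and>
    (\<forall>(n::nat) (k::int). n \<ge> 2 \<longrightarrow> k \<in> {0..int (n choose 2)} \<longrightarrow>
       num_intervals n k = (\<Sum>h = 0..n - 1. (n - h) * num_intervals (n - 1) (k - int h)))"
proof (intro conjI allI impI)
  \<comment> \<open>The box over the empty index set has a single point, so the recursion from
    \<open>0\<close> to \<open>1\<close> gives the initial value.\<close>
  have "box_pairs 0 0 = {(\<lambda>_. undefined, \<lambda>_. undefined)}"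
    by (auto simp: box_pairs_def inv_box_def)
  then show "num_intervals 1 0 = 1"
    by (simp add: num_intervals_eq_card_box_pairs card_box_pairs_Suc)
next
  fix n :: nat and k :: int
  assume "n \<ge> 2"
  then obtain m where "n = Suc m" by (cases n) auto
  then show "num_intervals n k = (\<Sum>h = 0..n - 1. (n - h) * num_intervals (n - 1) (k - int h))"
    by (simp add: num_intervals_eq_card_box_pairs card_box_pairs_Suc)
qed

end
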